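(* Let $\mathfrak{C}_{12}$ be the graph with vertex set $\{0,1,\dots,11\}$ in which $\{u,v\}$ is an edge iff $|u-v|\in\{1,3,9,11\}$, regarded as a bipartite graph with parts the even vertices and the odd vertices. Then $\mathfrak{C}_{12}$ is not constructible by conditioning.
   Context: A bipartite graph $(X,Y,E)$ with $E\subseteq X\times Y$ is viewed as a 2-partite hypergraph. A homomorphism $(X,Y,E)\to(X',Y',E')$ is a pair of maps $X\to X'$, $Y\to Y'$ mapping edges to edges. For $X_0\subseteq X,Y_0\subseteq Y$ the induced subgraph is $(X_0,Y_0,E\cap(X_0\times Y_0))$. Constructible by conditioning (recursively, up to renaming of vertices): (1) A single edge $(\{a\},\{b\},\{(a,b)\})$ is constructible. (2) Doubling: given a constructible graph whose vertices are partitioned into "fixed" and "old" vertices, add for every old vertex $q$ a fresh copy $q'$ on the same side, and for every edge $e$ not both of whose endpoints are fixed add the edge $e'$ obtained by replacing each old endpoint by its copy (keeping all previous edges); the result is constructible. (3) Collapse: if $H$ is constructible, $H_0$ is an induced subgraph of $H$, and some homomorphism $H\to H_0$ is the identity on the vertices of $H_0$, then $H_0$ is constructible. *)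

theory Defs
  imports Main
begin

text \<open>
  A bipartite graph is a triple \<open>(X, Y, E)\<close> with \<open>E \<subseteq> X \<times> Y\<close>. The two sides are told apart by
  their position in the triple, so \<open>X\<close> and \<open>Y\<close> may share names without sharing vertices.
\<close>
type_synonym ('a, 'b) bigraph = "'a set \<times> 'b set \<times> ('a \<times> 'b) set"

fun bipartite :: "('a, 'b) bigraph \<Rightarrow> bool" where
  "bipartite (X, Y, E) \<longleftrightarrow> E \<subseteq> X \<times> Y"

fun homomorphism ::
  "('a \<Rightarrow> 'c) \<Rightarrow> ('b \<Rightarrow> 'd) \<Rightarrow> ('a, 'b) bigraph \<Rightarrow> ('c, 'd) bigraph \<Rightarrow> bool" where
  "homomorphism f g (X, Y, E) (X', Y', E') \<longleftrightarrow>
     f ` X \<subseteq> X' \<and> g ` Y \<subseteq> Y' \<and> (\<forall>(x, y)\<in>E. (f x, g y) \<in> E')"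

fun induced_subgraph :: "('a, 'b) bigraph \<Rightarrow> 'a set \<Rightarrow> 'b set \<Rightarrow> ('a, 'b) bigraph" where
  "induced_subgraph (X, Y, E) X0 Y0 = (X0, Y0, E \<inter> (X0 \<times> Y0))"

fun rename :: "('a \<Rightarrow> 'c) \<Rightarrow> ('b \<Rightarrow> 'd) \<Rightarrow> ('a, 'b) bigraph \<Rightarrow> ('c, 'd) bigraph" where
  "rename f g (X, Y, E) = (f ` X, g ` Y, map_prod f g ` E)"

text \<open>
  \<open>FX\<close> and \<open>FY\<close> are the fixed vertices of the two sides, all other vertices are old.
  The maps \<open>c\<close> and \<open>d\<close> send each old vertex to its copy; their values on fixed
  vertices are irrelevant.
\<close>
definition fresh_copy :: "'a set \<Rightarrow> 'a set \<Rightarrow> ('a \<Rightarrow> 'a) \<Rightarrow> bool" where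
  "fresh_copy X FX c \<longleftrightarrow> inj_on c (X - FX) \<and> c ` (X - FX) \<inter> X = {}"

definition copy_old :: "'a set \<Rightarrow> ('a \<Rightarrow> 'a) \<Rightarrow> 'a \<Rightarrow> 'a" where
  "copy_old FX c x = (if x \<in> FX then x else c x)"

fun doubling ::
  "'a set \<Rightarrow> 'b set \<Rightarrow> ('a \<Rightarrow> 'a) \<Rightarrow> ('b \<Rightarrow> 'b) \<Rightarrow> ('a, 'b) bigraph \<Rightarrow> ('a, 'b) bigraph" where
  "doubling FX FY c d (X, Y, E) =
     (X \<union> c ` (X - FX), Y \<union> d ` (Y - FY),
      E \<union> {(copy_old FX c x, copy_old FY d y) | x y. (x, y) \<in> E \<and> \<not> (x \<in> FX \<and> y \<in> FY)})"

text \<open>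
  All constructible graphs are finite, so with the renaming rule nothing is lost by drawing
  the vertices of both sides from \<^typ>\<open>nat\<close>, which always has room for fresh copies.
\<close>
inductive constructible :: "(nat, nat) bigraph \<Rightarrow> bool" where
  single_edge: "constructible ({a}, {b}, {(a, b)})"
| doubling:
    "constructible (doubling FX FY c d (X, Y, E))"
    if "constructible (X, Y, E)" "FX \<subseteq> X" "FY \<subseteq> Y" "fresh_copy X FX c" "fresh_copy Y FY d"
| collapse:
    "constructible (induced_subgraph (X, Y, E) X0 Y0)"
    if "constructible (X, Y, E)" "X0 \<subseteq> X" "Y0 \<subseteq> Y"
       "homomorphism f g (X, Y, E) (induced_subgraph (X, Y, E) X0 Y0)"
       "\<forall>x\<in>X0. f x = x" "\<forall>y\<in>Y0. g y = y"
| renaming: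
    "constructible (rename f g (X, Y, E))"
    if "constructible (X, Y, E)" "inj_on f X" "inj_on g Y"

lemma constructible_bipartite: "constructible G \<Longrightarrow> bipartite G"
  by (induction rule: constructible.induct) (auto simp: copy_old_def split: if_splits)

lemma constructible_finite: "constructible (X, Y, E) \<Longrightarrow> finite X \<and> finite Y"
  by (induction "(X, Y, E)" arbitrary: X Y E rule: constructible.induct)
    (auto intro: finite_subset)

definition C12 :: "(nat, nat) bigraph" where
  "C12 =
     ({u \<in> {0..11}. even u}, {v \<in> {0..11}. odd v},
      {(u, v). u \<in> {0..11} \<and> v \<in> {0..11} \<and> even u \<and> odd v \<and>
               \<bar>int u - int v\<bar> \<in> {1, 3, 9, 11}})"

end

theory Submission
  imports Defs
begin

text \<open>
  Constructibility of \<open>G\<close> yields that \<open>C12\<close> is not a retract of \<open>G\<close>, by induction. The only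
  interesting step is a doubling of \<open>H\<close>. Suppose \<open>C12\<close> is a retract of the double. Following the
  embedding by the folding map onto \<open>H\<close> and then by the retraction, restricted to either of the two
  copies of \<open>H\<close>, gives two endomorphisms of \<open>C12\<close>. One of them fixes every vertex that is not
  embedded as a copy, the other every vertex that is not embedded as an old vertex. No even vertex
  embedded as an old vertex is adjacent to an odd vertex embedded as a copy. As two even vertices
  of \<open>C12\<close> have at most one common non-neighbour, there is at most one even vertex of the former or
  at most one odd vertex of the latter kind. Thus one of the two endomorphisms fixes all even
  vertices but one or all odd vertices but one. Such an endomorphism of \<open>C12\<close> is the identity,
  so \<open>C12\<close> is already a retract of \<open>H\<close>.
\<close>

section \<open>Retracts under composition, renaming and collapse\<close>

text \<open>Stated with an embedding instead of a subgraph, so that it is invariant under renaming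
  and the two graphs may have different vertex types.\<close>

fun retract :: "('a, 'b) bigraph \<Rightarrow> ('c, 'd) bigraph \<Rightarrow> bool" where
  "retract (X, Y, E) G \<longleftrightarrow>
     (\<exists>s t p q. homomorphism s t (X, Y, E) G \<and> homomorphism p q G (X, Y, E) \<and>
        (\<forall>x\<in>X. p (s x) = x) \<and> (\<forall>y\<in>Y. q (t y) = y))"

lemma homomorphism_comp:
  assumes "homomorphism f g G H" "homomorphism f' g' H K"
  shows "homomorphism (f' \<circ> f) (g' \<circ> g) G K"
  using assms by (cases G; cases H; cases K) fastforce

lemma retract_trans:
  assumes "retract F G" "retract G H"
  shows "retract F H"
proof -
  obtain X Y E X' Y' E' where FG: "F = (X, Y, E)" "G = (X', Y', E')"
    by (cases F; cases G)
  from assms(1) obtain s t p q where 1: "homomorphism s t F G" "homomorphism p q G F"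
    "\<forall>x\<in>X. p (s x) = x" "\<forall>y\<in>Y. q (t y) = y"
    unfolding FG by auto
  from assms(2) obtain s' t' p' q' where 2: "homomorphism s' t' G H" "homomorphism p' q' H G"
    "\<forall>x\<in>X'. p' (s' x) = x" "\<forall>y\<in>Y'. q' (t' y) = y"
    unfolding FG by auto
  have "s ` X \<subseteq> X'" "t ` Y \<subseteq> Y'" using 1(1) by (auto simp: FG)
  then have "\<forall>x\<in>X. (p \<circ> p') ((s' \<circ> s) x) = x" "\<forall>y\<in>Y. (q \<circ> q') ((t' \<circ> t) y) = y"
    using 1 2 by (auto simp: image_subset_iff)
  then show ?thesis
    using homomorphism_comp[OF 1(1) 2(1)] homomorphism_comp[OF 2(2) 1(2)]
    unfolding FG retract.simps by blast
qed

lemma retract_rename: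
  assumes "bipartite (X, Y, E)" "inj_on f X" "inj_on g Y"
  shows "retract (rename f g (X, Y, E)) (X, Y, E)"
proof -
  have "homomorphism (inv_into X f) (inv_into Y g) (rename f g (X, Y, E)) (X, Y, E)"
    using assms by (auto simp: subset_iff inv_into_f_f)
  moreover have "homomorphism f g (X, Y, E) (rename f g (X, Y, E))" by auto
  moreover have "\<forall>x\<in>f ` X. f (inv_into X f x) = x" "\<forall>y\<in>g ` Y. g (inv_into Y g y) = y"
    by (simp_all add: f_inv_into_f)
  ultimately show ?thesis unfolding rename.simps retract.simps by blast
qed

lemma retract_collapse:
  assumes "X0 \<subseteq> X" "Y0 \<subseteq> Y" "homomorphism f g (X, Y, E) (induced_subgraph (X, Y, E) X0 Y0)"
    "\<forall>x\<in>X0. f x = x" "\<forall>y\<in>Y0. g y = y"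
  shows "retract (induced_subgraph (X, Y, E) X0 Y0) (X, Y, E)"
proof -
  have "homomorphism (\<lambda>x. x) (\<lambda>y. y) (induced_subgraph (X, Y, E) X0 Y0) (X, Y, E)"
    using assms(1,2) by auto
  then show ?thesis
    using assms(3-5) unfolding induced_subgraph.simps retract.simps by blast
qed

section \<open>Folding a double\<close>

text \<open>One side of the folding map from the double to the original graph; values outside the
  double are irrelevant.\<close>

definition merge_copy :: "'a set \<Rightarrow> 'a set \<Rightarrow> ('a \<Rightarrow> 'a) \<Rightarrow> 'a \<Rightarrow> 'a" where
  "merge_copy X FX c z = (if z \<in> X then z else inv_into (X - FX) c z)"

lemma merge_copy_copy_old:
  "fresh_copy X FX c \<Longrightarrow> x \<in> X \<Longrightarrow> merge_copy X FX c (copy_old FX c x) = x"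
  by (auto simp: merge_copy_def copy_old_def fresh_copy_def inv_into_f_f)

lemma copy_old_merge_copy:
  "fresh_copy X FX c \<Longrightarrow> z \<in> FX \<union> c ` (X - FX) \<Longrightarrow> FX \<subseteq> X \<Longrightarrow>
    copy_old FX c (merge_copy X FX c z) = z"
  by (auto simp: merge_copy_def copy_old_def fresh_copy_def inv_into_f_f)

text \<open>
  \<open>A\<close> consists of the vertices embedded as old ones and \<open>B\<close> of those embedded as copies.
\<close>
lemma retract_doubling:
  assumes ret: "retract (V, W, R) (doubling FX FY c d (X, Y, E))"
    and bip: "bipartite (X, Y, E)"
    and FX: "FX \<subseteq> X" "fresh_copy X FX c"
    and FY: "FY \<subseteq> Y" "fresh_copy Y FY d"
  obtains A B s t p q p' q' where
    "homomorphism s t (V, W, R) (X, Y, E)"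
    "homomorphism p q (X, Y, E) (V, W, R)" "homomorphism p' q' (X, Y, E) (V, W, R)"
    "R \<inter> A \<times> B = {}" "\<forall>x\<in>V - A. p' (s x) = x" "\<forall>y\<in>W - B. q (t y) = y"
proof -
  let ?D = "doubling FX FY c d (X, Y, E)"
  let ?m = "merge_copy X FX c" and ?n = "merge_copy Y FY d"
  let ?c = "copy_old FX c" and ?d = "copy_old FY d"
  from ret obtain s t p q where st: "homomorphism s t (V, W, R) ?D"
    and pq: "homomorphism p q ?D (V, W, R)"
    and id: "\<forall>x\<in>V. p (s x) = x" "\<forall>y\<in>W. q (t y) = y"
    unfolding retract.simps by blast
  have E: "E \<subseteq> X \<times> Y" using bip by simp
  have "homomorphism ?m ?n ?D (X, Y, E)"
  proof -
    have old: "?m x = x" if "x \<in> X" for x using that by (simp add: merge_copy_def)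
    have old': "?n y = y" if "y \<in> Y" for y using that by (simp add: merge_copy_def)
    have copy: "?m (c x) = x" if "x \<in> X - FX" for x
      using merge_copy_copy_old[OF FX(2), of x] that by (simp add: copy_old_def)
    have copy': "?n (d y) = y" if "y \<in> Y - FY" for y
      using merge_copy_copy_old[OF FY(2), of y] that by (simp add: copy_old_def)
    have edge: "(?m x, ?n y) \<in> E" "(?m (?c x), ?n (?d y)) \<in> E" if "(x, y) \<in> E" for x y
    proof -
      have "x \<in> X" "y \<in> Y" using that E by auto
      then show "(?m x, ?n y) \<in> E" "(?m (?c x), ?n (?d y)) \<in> E"
        using that merge_copy_copy_old[OF FX(2)] merge_copy_copy_old[OF FY(2)]
        by (simp_all add: old old')
    qed
    have "?m ` (X \<union> c ` (X - FX)) \<subseteq> X" "?n ` (Y \<union> d ` (Y - FY)) \<subseteq> Y"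
      by (auto simp: old old' copy copy')
    then show ?thesis using edge by auto
  qed
  then have hs: "homomorphism (?m \<circ> s) (?n \<circ> t) (V, W, R) (X, Y, E)"
    by (rule homomorphism_comp[OF st])
  have hp: "homomorphism p q (X, Y, E) (V, W, R)" using pq by auto
  \<comment> \<open>The second embedding of \<open>(X, Y, E)\<close>, onto fixed vertices and
    copies. An edge with both ends fixed is not duplicated but maps to itself.\<close>
  have "homomorphism ?c ?d (X, Y, E) ?D"
  proof -
    have "?c ` X \<subseteq> X \<union> c ` (X - FX)" "?d ` Y \<subseteq> Y \<union> d ` (Y - FY)"
      by (auto simp: copy_old_def)
    moreover have "(?c x, ?d y) \<in> E \<union> {(?c x, ?d y) | x y. (x, y) \<in> E \<and> \<not> (x \<in> FX \<and> y \<in> FY)}"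
      if "(x, y) \<in> E" for x y
    proof (cases "x \<in> FX \<and> y \<in> FY")
      case True
      then show ?thesis using that by (simp add: copy_old_def)
    next
      case False
      then show ?thesis using that by blast
    qed
    ultimately show ?thesis unfolding homomorphism.simps doubling.simps by blast
  qed
  then have hp': "homomorphism (p \<circ> ?c) (q \<circ> ?d) (X, Y, E) (V, W, R)"
    by (rule homomorphism_comp[OF _ pq])
  \<comment> \<open>Vertices embedded as fixed ones lie in neither set: both embeddings of
    \<open>(X, Y, E)\<close> agree there.\<close>
  let ?A = "{x. s x \<in> X - FX}" and ?B = "{y. t y \<notin> Y}"
  have old: "x \<in> FX" if "?c x \<in> X" "x \<in> X" for x
    using that FX by (auto simp: copy_old_def fresh_copy_def split: if_splits)
  \<comment> \<open>Edges of \<open>E\<close> end in \<open>Y\<close>, and duplicated edges start at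
    a fixed vertex or a copy.\<close>
  have "R \<inter> ?A \<times> ?B = {}"
  proof -
    have edge: "\<forall>(x, y)\<in>R. (s x, t y) \<in> E \<union> {(?c x, ?d y) | x y. (x, y) \<in> E \<and> \<not> (x \<in> FX \<and> y \<in> FY)}"
      using st unfolding homomorphism.simps doubling.simps by (elim conjE)
    have False if "(x, y) \<in> R" "s x \<in> X - FX" "t y \<notin> Y" for x y
    proof -
      have "(s x, t y) \<notin> E" using that(3) E by blast
      with bspec[OF edge that(1)] obtain u v where uv: "s x = ?c u" "(u, v) \<in> E" by auto
      have "u \<in> X" using uv(2) E by blast
      then have "u \<in> FX" using old[of u] that(2) uv(1) by simp
      then show False using uv(1) that(2) by (simp add: copy_old_def)
    qed
    then show ?thesis by blast
  qed
  moreover have "\<forall>x\<in>V - ?A. (p \<circ> ?c) ((?m \<circ> s) x) = x"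
  proof
    fix x assume x: "x \<in> V - ?A"
    then have "s x \<in> FX \<union> c ` (X - FX)" using st by auto
    from copy_old_merge_copy[OF FX(2) this FX(1)] show "(p \<circ> ?c) ((?m \<circ> s) x) = x"
      using id(1) x by simp
  qed
  moreover have "\<forall>y\<in>W - ?B. q ((?n \<circ> t) y) = y"
    using id(2) by (simp add: merge_copy_def)
  ultimately show thesis by (rule that[OF hs hp hp'])
qed

section \<open>Rigidity of endomorphisms\<close>

text \<open>
  If \<open>f\<close> moved only \<open>a\<close>, say to \<open>k\<close>, then some \<open>y\<close> would have no possible image.
\<close>
lemma endomorphism_eq_id:
  assumes f: "\<forall>x\<in>X. f x \<in> X" and g: "\<forall>y\<in>Y. g y \<in> Y"
    and hom: "\<forall>x\<in>X. \<forall>y\<in>Y. adj x y \<longrightarrow> adj (f x) (g y)"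
    and fix1: "\<forall>x\<in>X - {a}. f x = x"
    and move: "\<forall>a\<in>X. \<forall>k\<in>X. k \<noteq> a \<longrightarrow>
      (\<exists>y\<in>Y. \<forall>w\<in>Y. \<exists>x\<in>X. adj x y \<and> \<not> adj (if x = a then k else x) w)"
    and stiff: "\<forall>y\<in>Y. \<forall>w\<in>Y. w \<noteq> y \<longrightarrow> (\<exists>x\<in>X. adj x y \<and> \<not> adj x w)"
  shows "(\<forall>x\<in>X. f x = x) \<and> (\<forall>y\<in>Y. g y = y)"
proof -
  have "f a = a" if a: "a \<in> X"
  proof (rule ccontr)
    assume "f a \<noteq> a"
    with move a f obtain y where "y \<in> Y"
      and y: "\<forall>w\<in>Y. \<exists>x\<in>X. adj x y \<and> \<not> adj (if x = a then f a else x) w"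
      by fast
    then obtain x where x: "x \<in> X" "adj x y" "\<not> adj (if x = a then f a else x) (g y)"
      using g by fast
    moreover have "(if x = a then f a else x) = f x" using fix1 x(1) by simp
    ultimately show False using hom \<open>y \<in> Y\<close> by simp
  qed
  then have fx: "f x = x" if "x \<in> X" for x using fix1 that by blast
  \<comment> \<open>Since \<open>f\<close> is the identity, all neighbours of \<open>y\<close> are
    neighbours of \<open>g y\<close>.\<close>
  have "g y = y" if y: "y \<in> Y" for y
  proof (rule ccontr)
    assume "g y \<noteq> y"
    with stiff y g obtain x where x: "x \<in> X" "adj x y" "\<not> adj x (g y)" by fast
    then have "adj (f x) (g y)" using hom y by blast
    then show False using x fx by simp
  qed
  with fx show ?thesis by blast
qed

definition evens :: "nat set" where "evens = {0, 2, 4, 6, 8, 10}"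
definition odds :: "nat set" where "odds = {1, 3, 5, 7, 9, 11}"
text \<open>On vertices of opposite parity: a difference of 1 or 3 modulo 12, up to sign. The other
  such pairs differ by 5 modulo 12, up to sign, and form a 12-cycle.\<close>

definition adj :: "nat \<Rightarrow> nat \<Rightarrow> bool" where "adj u v \<longleftrightarrow> \<bar>int u - int v\<bar> \<in> {1, 3, 9, 11}"

lemma C12_eq: "C12 = (evens, odds, {(u, v). u \<in> evens \<and> v \<in> odds \<and> adj u v})"
proof -
  have "{u \<in> {0..11}. even u} = evens" "{v \<in> {0..11}. odd v} = odds"
    by (code_simp, code_simp)
  then show ?thesis unfolding C12_def adj_def by blast
qed

lemma C12_stiff:
  "\<forall>y\<in>odds. \<forall>w\<in>odds. w \<noteq> y \<longrightarrow> (\<exists>x\<in>evens. adj x y \<and> \<not> adj x w)"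
  "\<forall>x\<in>evens. \<forall>w\<in>evens. w \<noteq> x \<longrightarrow> (\<exists>y\<in>odds. adj x y \<and> \<not> adj w y)"
  by code_simp+

text \<open>Each \<open>w\<close> misses exactly two vertices of the other side, and these differ by
  2 modulo 12. Choose \<open>y\<close> missing \<open>k\<close> and a vertex \<open>m\<close> such
  that \<open>a\<close> is neither \<open>m\<close> nor at distance 2 from it. Moving
  \<open>a\<close> to \<open>k\<close> makes the neighbourhood of \<open>y\<close> the complement of
  \<open>a\<close> and \<open>m\<close>, which lies in no neighbourhood.\<close>

lemma C12_move:
  "\<forall>a\<in>evens. \<forall>k\<in>evens. k \<noteq> a \<longrightarrow>
    (\<exists>y\<in>odds. \<forall>w\<in>odds. \<exists>x\<in>evens. adj x y \<and> \<not> adj (if x = a then k else x) w)"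
  "\<forall>b\<in>odds. \<forall>k\<in>odds. k \<noteq> b \<longrightarrow>
    (\<exists>x\<in>evens. \<forall>w\<in>evens. \<exists>y\<in>odds. adj x y \<and> \<not> adj w (if y = b then k else y))"
  by code_simp+

lemma C12_endomorphism_eq_id:
  assumes "homomorphism f g C12 C12"
    and "(\<exists>a. \<forall>x\<in>evens - {a}. f x = x) \<or> (\<exists>b. \<forall>y\<in>odds - {b}. g y = y)"
  shows "(\<forall>x\<in>evens. f x = x) \<and> (\<forall>y\<in>odds. g y = y)"
proof -
  have f: "\<forall>x\<in>evens. f x \<in> evens" and g: "\<forall>y\<in>odds. g y \<in> odds"
    and hom: "\<forall>x\<in>evens. \<forall>y\<in>odds. adj x y \<longrightarrow> adj (f x) (g y)"
    using assms(1) by (auto simp: C12_eq)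
  have hom': "\<forall>y\<in>odds. \<forall>x\<in>evens. adj x y \<longrightarrow> adj (f x) (g y)"
    using hom by blast
  from assms(2) show ?thesis
  proof (elim disjE exE)
    fix a assume "\<forall>x\<in>evens - {a}. f x = x"
    then show ?thesis by (rule endomorphism_eq_id[OF f g hom _ C12_move(1) C12_stiff(1)])
  next
    fix b assume "\<forall>y\<in>odds - {b}. g y = y"
    then have "(\<forall>y\<in>odds. g y = y) \<and> (\<forall>x\<in>evens. f x = x)"
      by (rule endomorphism_eq_id[where adj = "\<lambda>y x. adj x y", OF g f hom' _ C12_move(2) C12_stiff(2)])
    then show ?thesis by (rule conj_commute[THEN iffD1])
  qed
qed

text \<open>The 12-cycle of non-adjacent pairs contains no 4-cycle.\<close>

lemma C12_common_non_neighbour: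
  "\<forall>a\<in>evens. \<forall>a'\<in>evens. \<forall>b\<in>odds. \<forall>b'\<in>odds. a \<noteq> a' \<longrightarrow> b \<noteq> b' \<longrightarrow>
    adj a b \<or> adj a b' \<or> adj a' b \<or> adj a' b'"
  by code_simp

section \<open>Induction over constructions\<close>

lemma retract_C12_doubling:
  assumes ret: "retract C12 (doubling FX FY c d (X, Y, E))"
    and bip: "bipartite (X, Y, E)"
    and F: "FX \<subseteq> X" "FY \<subseteq> Y" "fresh_copy X FX c" "fresh_copy Y FY d"
  shows "retract C12 (X, Y, E)"
proof -
  obtain A B s t p q p' q' where
    hom: "homomorphism s t C12 (X, Y, E)"
      "homomorphism p q (X, Y, E) C12" "homomorphism p' q' (X, Y, E) C12"
    and AB: "{(u, v). u \<in> evens \<and> v \<in> odds \<and> adj u v} \<inter> A \<times> B = {}"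
    and fixed: "\<forall>x\<in>evens - A. p' (s x) = x" "\<forall>y\<in>odds - B. q (t y) = y"
    using retract_doubling[OF ret[unfolded C12_eq] bip F(1,3,2,4), folded C12_eq] .
  \<comment> \<open>By rigidity, a retraction of \<open>s\<close> and \<open>t\<close> that is
    correct on one side up to a single vertex is correct everywhere.\<close>
  have retI: "retract C12 (X, Y, E)"
    if "homomorphism r r' (X, Y, E) C12"
      "(\<exists>a. \<forall>x\<in>evens - {a}. r (s x) = x) \<or> (\<exists>b. \<forall>y\<in>odds - {b}. r' (t y) = y)" for r r'
    using C12_endomorphism_eq_id[OF homomorphism_comp[OF hom(1) that(1)]] that hom(1)
    unfolding C12_eq retract.simps comp_def by blast
  have non_adj: "\<not> adj a b" if "a \<in> evens \<inter> A" "b \<in> odds \<inter> B" for a b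
    using that AB by blast
  have "(\<exists>a. evens \<inter> A \<subseteq> {a}) \<or> (\<exists>b. odds \<inter> B \<subseteq> {b})"
  proof (rule ccontr)
    assume "\<not> ?thesis"
    then have *: "\<not> evens \<inter> A \<subseteq> {a}" "\<not> odds \<inter> B \<subseteq> {b}" for a b by simp_all
    \<comment> \<open>The value 0 is arbitrary; only non-emptiness is extracted.\<close>
    from *(1)[of 0] obtain a where a: "a \<in> evens \<inter> A" by blast
    from *(1)[of a] obtain a' where a': "a' \<in> evens \<inter> A" "a \<noteq> a'" by blast
    from *(2)[of 0] obtain b where b: "b \<in> odds \<inter> B" by blast
    from *(2)[of b] obtain b' where b': "b' \<in> odds \<inter> B" "b \<noteq> b'" by blast
    have "adj a b \<or> adj a b' \<or> adj a' b \<or> adj a' b'"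
      using a a' b b' by (intro C12_common_non_neighbour[rule_format]) simp_all
    then show False using non_adj a a'(1) b b'(1) by blast
  qed
  then show ?thesis
  proof
    assume "\<exists>a. evens \<inter> A \<subseteq> {a}"
    then have "\<exists>a. \<forall>x\<in>evens - {a}. p' (s x) = x" using fixed(1) by blast
    then show ?thesis using retI[OF hom(3)] by blast
  next
    assume "\<exists>b. odds \<inter> B \<subseteq> {b}"
    then have "\<exists>b. \<forall>y\<in>odds - {b}. q (t y) = y" using fixed(2) by blast
    then show ?thesis using retI[OF hom(2)] by blast
  qed
qed

text \<open>Excluding \<open>C12\<close> as a retract, and not merely up to isomorphism, is what
  survives a collapse: retracts of retracts are retracts.\<close>

lemma constructible_not_retract_C12: "constructible G \<Longrightarrow> \<not> retract C12 G"
proof (induction rule: constructible.induct)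
  case (single_edge a b)
  show ?case
  proof
    assume "retract C12 ({a}, {b}, {(a, b)})"
    then obtain s t p q where "homomorphism s t C12 ({a}, {b}, {(a, b)})"
      and id: "\<forall>x\<in>evens. p (s x) = x"
      unfolding C12_eq retract.simps by blast
    then have "\<forall>x\<in>evens. s x = a" by (auto simp: C12_eq)
    then have "\<forall>x\<in>evens. x = p a" using id by simp
    then show False by (auto simp: evens_def)
  qed
next
  case (doubling X Y E FX FY c d)
  then show ?case
    using retract_C12_doubling[OF _ constructible_bipartite[OF doubling.hyps(1)]] by metis
next
  case (collapse X Y E X0 Y0 f g)
  then show ?case
    using retract_trans[OF _ retract_collapse[OF collapse.hyps(2-6)]] by metis
next
  case (renaming X Y E f g)
  then show ?case
    using retract_trans[OF _ retract_rename[OF constructible_bipartite[OF renaming.hyps(1)]]]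
    by metis
qed

theorem theorem8p2: "\<not> constructible C12"
proof
  assume "constructible C12"
  then have "\<not> retract C12 C12" by (rule constructible_not_retract_C12)
  moreover have "homomorphism (\<lambda>x. x) (\<lambda>y. y) C12 C12" by (auto simp: C12_eq)
  ultimately show False unfolding C12_eq retract.simps by blast
qed

end
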